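(* Let $p$ and $q$ be positive coprime integers with $p\geqslant 59\,q$, and let $$Q_{pq}(t)=t^{10}+(2q^2+p^2)(3q^2-2p^2)\,t^8+(q^8+10p^2q^6+4p^4q^4-14p^6q^2+p^8)\,t^6-p^2q^2(q^8-14p^2q^6+4p^4q^4+10p^6q^2+p^8)\,t^4-p^6q^6(q^2+2p^2)(3p^2-2q^2)\,t^2-q^{10}p^{10}.$$ Then every integer $t$ with $Q_{pq}(t)=0$ that provides a perfect cuboid (i.e. satisfies $t>p^2$, $t>pq$, $t>q^2$ and $(p^2+t)(pq+t)>2t^2$) lies in the open interval $$p^2+2qp-2q^2<t<p^2+2qp-2q^2+\frac{9q^3}{p}.$$ Equivalently, the equation $Q_{pq}(t)=0$ has no solutions providing perfect cuboids outside this interval.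
   Context: The equation $Q_{pq}(t)=0$ is the reduced cuboid characteristic equation arising in the case of the second cuboid conjecture. A triple of integers $p,q,t$ with $p\neq q$ positive and coprime and $Q_{pq}(t)=0$ is said to provide a perfect cuboid (a rectangular parallelepiped with integer edges, face diagonals and space diagonal) if and only if $t>p^2$, $t>pq$, $t>q^2$ and $(p^2+t)(pq+t)>2t^2$; this equivalence is taken from earlier work and is used here as the definition. *)

theory Defs
  imports Complex_Main
begin

definition cuboid_Q :: "int \<Rightarrow> int \<Rightarrow> int \<Rightarrow> int" where
  "cuboid_Q p q t =
     t^10
   + (2*q^2 + p^2) * (3*q^2 - 2*p^2) * t^8
   + (q^8 + 10*p^2*q^6 + 4*p^4*q^4 - 14*p^6*q^2 + p^8) * t^6
   - p^2*q^2 * (q^8 - 14*p^2*q^6 + 4*p^4*q^4 + 10*p^6*q^2 + p^8) * t^4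
   - p^6*q^6 * (q^2 + 2*p^2) * (3*p^2 - 2*q^2) * t^2
   - q^10*p^10"

(* The notion is meant only for distinct positive coprime p, q with cuboid_Q p q t = 0;
   for such triples these inequalities are, by convention, what it means to provide a
   perfect cuboid.  The side conditions on p, q, t are not part of the definition. *)
definition provides_perfect_cuboid :: "int \<Rightarrow> int \<Rightarrow> int \<Rightarrow> bool" where
  "provides_perfect_cuboid p q t \<longleftrightarrow>
     t > p^2 \<and> t > p*q \<and> t > q^2 \<and> (p^2 + t) * (p*q + t) > 2*t^2"

end

theory Submission
  imports Defs
begin

text \<open>
  By homogeneity put $x = p/q \ge 59$ and $s = t/q^2$. The perfect cuboid inequality is
  quadratic in $s$ and alone gives the upper bound. For the lower bound write $s = x^2 + y$.
  As a polynomial in $y$, the form $Q$ has a negative constant term and nonnegative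
  coefficients from degree 2 on, so on $0 \le y \le 2x - 2$ it is convex and hence negative
  as soon as it is negative at $y = 2x - 2$.
\<close>

definition scaled_Q :: "real \<Rightarrow> real \<Rightarrow> real" where
  "scaled_Q x s =
     s^10
   + (2 + x^2) * (3 - 2*x^2) * s^8
   + (1 + 10*x^2 + 4*x^4 - 14*x^6 + x^8) * s^6
   - x^2 * (1 - 14*x^2 + 4*x^4 + 10*x^6 + x^8) * s^4
   - x^6 * (1 + 2*x^2) * (3*x^2 - 2) * s^2
   - x^10"

text \<open>Giving \<open>p\<close> and \<open>q\<close> weight 1 and \<open>t\<close> weight 2
  makes every monomial of the form have weight 20, hence the factor \<open>q ^ 20\<close>.\<close>

lemma of_int_cuboid_Q:
  fixes p q t :: int
  assumes "q \<noteq> 0"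
  shows "real_of_int (cuboid_Q p q t) =
    of_int q ^ 20 * scaled_Q (of_int p / of_int q) (of_int t / (of_int q)^2)"
proof -
  define b x s :: real
    where "b = of_int q" and "x = of_int p / of_int q" and "s = of_int t / (of_int q)^2"
  have *: "real_of_int p = x * b" "real_of_int t = s * b^2" "real_of_int q = b"
    using assms by (simp_all add: b_def x_def s_def)
  have "real_of_int (cuboid_Q p q t) = b ^ 20 * scaled_Q x s"
    unfolding cuboid_Q_def scaled_Q_def by (simp add: *) algebra
  then show ?thesis
    by (simp add: b_def x_def s_def)
qed

lemma scaled_Q_at_lower_end_neg:
  fixes x :: real
  assumes "x \<ge> 59"
  shows "scaled_Q x (x^2 + (2*x - 2)) < 0"
proof -
  have eq: "scaled_Q x (x^2 + (2*x - 2)) =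
      - 80*x^16 - 800*x^15 - 2208*x^14 + 2144*x^13 + 16320*x^12 + 960*x^11 - 57536*x^10
      - 2048*x^9 + 128336*x^8 - 46048*x^7 - 158624*x^6 + 150560*x^5 + 32208*x^4
      - 121856*x^3 + 78960*x^2 - 22912*x + 2624"
    unfolding scaled_Q_def by algebra
  \<comment> \<open>All positive terms have degree at most 13, and their coefficients sum to 412112.
    This is far below 80 * 59^3 = 16430320, so the leading term \<open>- 80*x^16\<close>
    dominates.\<close>
  have le: "x^k \<le> x^13" if "k \<le> 13" for k
    using assms that by (intro power_increasing) auto
  have nonneg: "0 \<le> x^k" for k
    using assms by simp
  have "59^3 * x^13 \<le> x^3 * x^13"
    using assms by (intro mult_right_mono power_mono) auto
  then have top: "205379 * x^13 \<le> x^16"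
    by (simp flip: power_add)
  have "0 < x^13"
    using assms by simp
  then show ?thesis
    unfolding eq
    using top assms le[of 12, simplified] le[of 11, simplified] le[of 8, simplified]
      le[of 5, simplified] le[of 4, simplified] le[of 2, simplified] le[of 0, simplified]
      nonneg[of 15] nonneg[of 14] nonneg[of 10] nonneg[of 9] nonneg[of 7] nonneg[of 6]
      nonneg[of 3]
    by linarith
qed

lemma scaled_Q_below_lower_end_neg:
  fixes x y :: real
  assumes x: "x \<ge> 59" and y: "0 \<le> y" "y \<le> 2*x - 2"
  shows "scaled_Q x (x^2 + y) < 0"
proof -
  \<comment> \<open>Here 3481 = 59^2. Chaining these bounds over even powers turns each sign check
    for a coefficient into linear arithmetic.\<close>
  have step: "3481 * x^k \<le> x^(k + 2)" for k
  proof -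
    have "59^2 * x^k \<le> x^2 * x^k"
      using x by (intro mult_right_mono power_mono) auto
    then show ?thesis
      by (simp add: mult.commute flip: power_add)
  qed
  have "59^2 \<le> x^2"
    using x by (intro power_mono) auto
  then have "3481 \<le> x^2"
    by simp
  note powers = this step[of 2, simplified] step[of 4, simplified]
    step[of 6, simplified] step[of 8, simplified] step[of 10, simplified]
    step[of 12, simplified] step[of 14, simplified]
  \<comment> \<open>\<open>c0\<close> to \<open>c9\<close> are the Taylor coefficients of
    \<open>scaled_Q x\<close> at \<open>x^2\<close>; the coefficient of degree 10 is 1.\<close>
  define c0 where "c0 = - 16*x^18 + 16*x^12"
  define c1 where "c1 = - 96*x^16 + 32*x^14 + 32*x^12 + 64*x^10"
  define c2 where "c2 = 4*x^16 - 244*x^14 + 168*x^12 + 120*x^10 + 100*x^8 - 4*x^6"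
  define c3 where "c3 = 28*x^14 - 340*x^12 + 376*x^10 + 184*x^8 + 76*x^6 - 4*x^4"
  define c4 where "c4 = 85*x^12 - 281*x^10 + 470*x^8 + 146*x^6 + 29*x^4 - x^2"
  define c5 where "c5 = 146*x^10 - 140*x^8 + 360*x^6 + 60*x^4 + 6*x^2"
  define c6 where "c6 = 155*x^8 - 42*x^6 + 172*x^4 + 10*x^2 + 1"
  define c7 where "c7 = 104*x^6 - 8*x^4 + 48*x^2"
  define c8 where "c8 = 43*x^4 - x^2 + 6"
  define c9 where "c9 = 10*x^2"
  have coeffs: "0 \<le> c2" "0 \<le> c3" "0 \<le> c4" "0 \<le> c5" "0 \<le> c6" "0 \<le> c7" "0 \<le> c8" "0 \<le> c9"
    unfolding c2_def c3_def c4_def c5_def c6_def c7_def c8_def c9_def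
    using powers by linarith+
  have c0: "c0 < 0"
  proof -
    have "x^12 < x^18"
      using x by (intro power_strict_increasing) auto
    then show ?thesis
      by (simp add: c0_def)
  qed
  \<comment> \<open>\<open>g\<close> is the slope of the chord from 0 to \<open>z\<close>. Convexity
    enters only as monotonicity of this slope for \<open>z\<close> \<ge> 0.\<close>
  define g where "g z = c1 + (c2*z + c3*z^2 + c4*z^3 + c5*z^4 + c6*z^5 + c7*z^6 + c8*z^7
    + c9*z^8 + z^9)" for z
  have eq: "scaled_Q x (x^2 + z) = c0 + z * g z" for z
    unfolding scaled_Q_def g_def c0_def c1_def c2_def c3_def c4_def c5_def c6_def c7_def
      c8_def c9_def
    by algebra
  have g_mono: "g y \<le> g (2*x - 2)"
    unfolding g_def using y coeffs by (intro add_mono mult_left_mono power_mono) auto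
  show ?thesis
  \<comment> \<open>If the slope at the right end is nonpositive, the value at \<open>y\<close> is
    at most \<open>c0\<close>; otherwise it is at most the value at the right end. Both are
    negative.\<close>
  proof (cases "g (2*x - 2) \<le> 0")
    case True
    then have "y * g y \<le> 0"
      using y g_mono by (simp add: mult_nonneg_nonpos)
    then show ?thesis
      using c0 by (simp add: eq)
  next
    case False
    then have "y * g y \<le> (2*x - 2) * g (2*x - 2)"
      using y g_mono by (meson mult_left_mono mult_right_mono nle_le order_trans)
    then show ?thesis
      using scaled_Q_at_lower_end_neg[OF x] unfolding eq by linarith
  qed
qed

text \<open>The hypothesis rearranges to \<open>s * (s - x^2 - x) < x^3\<close>, so \<open>s\<close>
  lies below the positive root of a quadratic. For large \<open>x\<close> that root expands as
  \<open>x^2 + 2*x - 2 + 6/x + ...\<close>, and 9 leaves room for the remainder.\<close>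

lemma cuboid_inequality_upper_bound:
  fixes x s :: real
  assumes x: "x \<ge> 2" and s: "(x^2 + s) * (x + s) > 2 * s^2"
  shows "s < x^2 + 2*x - 2 + 9/x"
proof (rule ccontr)
  define r where "r = 9/x"
  define u where "u = x^2 + 2*x - 2 + r"
  assume "\<not> ?thesis"
  then have "u \<le> s"
    by (simp add: u_def r_def)
  have r: "0 < r" "r * x = 9" "r \<le> 9/2"
    using x by (simp_all add: r_def field_simps)
  have u: "0 \<le> u" "0 \<le> u - x^2 - x"
    using x r(1) zero_le_power2[of x] unfolding u_def by linarith+
  have "x^3 \<le> u * (u - x^2 - x)"
  proof -
    \<comment> \<open>The last product isolates a multiple of \<open>r*x - 9\<close>, which vanishes
      by the choice of \<open>r\<close>.\<close>
    have "u * (u - x^2 - x) - x^3 = 3*x + 31 - 4*r + r^2 + (r*x - 9) * (x + 3)"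
      by (simp add: u_def algebra_simps power2_eq_square power3_eq_cube)
    also have "\<dots> = 3*x + 31 - 4*r + r^2"
      by (simp add: r(2))
    also have "\<dots> \<ge> 0"
      using x r(3) zero_le_power2[of r] by linarith
    finally show ?thesis
      by simp
  qed
  also have "\<dots> \<le> s * (s - x^2 - x)"
    using u \<open>u \<le> s\<close> by (intro mult_mono) auto
  finally show False
    using s by (simp add: algebra_simps power2_eq_square power3_eq_cube)
qed

theorem theorem8p4:
  fixes p q t :: int
  assumes "p > 0" and "q > 0" and "coprime p q" and "p \<ge> 59 * q"
    and "cuboid_Q p q t = 0"
    and "provides_perfect_cuboid p q t"
  shows "real_of_int t \<in>
    {real_of_int (p^2 + 2*q*p - 2*q^2) <..<
     real_of_int (p^2 + 2*q*p - 2*q^2) + 9 * (real_of_int q)^3 / real_of_int p}"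
proof -
  define b x s :: real
    where "b = of_int q" and "x = of_int p / of_int q" and "s = of_int t / (of_int q)^2"
  have b: "b > 0"
    using \<open>q > 0\<close> by (simp add: b_def)
  have *: "real_of_int p = x * b" "real_of_int t = s * b^2" "real_of_int q = b"
    using \<open>q > 0\<close> by (simp_all add: b_def x_def s_def)
  have "real_of_int (59 * q) \<le> real_of_int p"
    using \<open>p \<ge> 59 * q\<close> by (simp only: of_int_le_iff)
  then have x: "x \<ge> 59"
    using b by (simp add: *)
  have "t > p^2" and ineq: "(p^2 + t) * (p*q + t) > 2*t^2"
    using \<open>provides_perfect_cuboid p q t\<close> by (auto simp: provides_perfect_cuboid_def)
  have "real_of_int t > real_of_int (p^2)"
    using \<open>t > p^2\<close> by (simp only: of_int_less_iff)
  then have "x^2 * b^2 < s * b^2"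
    by (simp add: * power_mult_distrib)
  then have "x^2 < s"
    using b by simp
  have "real_of_int ((p^2 + t) * (p*q + t)) > real_of_int (2*t^2)"
    using ineq by (simp only: of_int_less_iff)
  \<comment> \<open>Both sides have weight 4, so \<open>b^4\<close> cancels.\<close>
  then have "2 * s^2 * b^4 < (x^2 + s) * (x + s) * b^4"
    by (simp add: * algebra_simps power2_eq_square power4_eq_xxxx)
  then have "2 * s^2 < (x^2 + s) * (x + s)"
    using b by simp
  then have upper: "s < x^2 + 2*x - 2 + 9/x"
    using x by (intro cuboid_inequality_upper_bound) auto
  have "scaled_Q x s = 0"
    using of_int_cuboid_Q[of q p t] \<open>cuboid_Q p q t = 0\<close> \<open>q > 0\<close> by (simp add: x_def s_def)
  \<comment> \<open>Otherwise \<open>s - x^2\<close> would lie between 0 and \<open>2*x - 2\<close>,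
    where \<open>scaled_Q\<close> is negative and cannot vanish.\<close>
  then have lower: "x^2 + 2*x - 2 < s"
    using scaled_Q_below_lower_end_neg[OF x, of "s - x^2"] \<open>x^2 < s\<close> by force
  have low_eq: "real_of_int (p^2 + 2*q*p - 2*q^2) = (x^2 + 2*x - 2) * b^2"
    by (simp add: * algebra_simps power2_eq_square)
  have high_eq: "9 * (real_of_int q)^3 / real_of_int p = 9/x * b^2"
    using b x by (simp add: * field_simps power2_eq_square power3_eq_cube)
  have "(x^2 + 2*x - 2) * b^2 < s * b^2" "s * b^2 < (x^2 + 2*x - 2 + 9/x) * b^2"
    using lower upper b by (simp_all add: mult_strict_right_mono)
  then show ?thesis
    unfolding low_eq high_eq *(2) by (simp add: distrib_right)
qed

end
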